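(* Let $F=\langle X,D,C\rangle$ be a CSP instance, let $s_F:X\times D\to\mathbb{R}_{\ge 0}$ be a weighting seed, let $w_F:\mathcal{S}(F)\times X\to\mathbb{R}$ be an actual weight, let $(\delta_{F,\sigma,x,a})_{\sigma\in\mathcal{S}(F),x\in X,a\in D}$ be a family of real numbers, and let $S\subseteq\mathcal{S}(F)$. Suppose that: (1) the weighting seed $s_F$ is unitary; (2) $w_F$ is decomposable by the family $(\delta_{F,\sigma,x,a})$; (3) $(T_F,S)$ covers $U_F$. Then $W_F(S)\ge 1$.
   Context: A CSP instance is a triple $F=\langle X,D,C\rangle$ with $X$ a finite set of variables, $D$ a finite domain of values, and $C$ a set of constraints; a constraint is a pair $\langle (x_1,\dots,x_k),R\rangle$ with $(x_1,\dots,x_k)\in X^k$, $R\subseteq D^k$, for some integer $k$. A valuation is a map $v\in D^X$; it satisfies the constraint iff $(v(x_1),\dots,v(x_k))\in R$. A solution of $F$ is a valuation satisfying all constraints; $\mathcal{S}(F)$ is the set of solutions. A weighting seed is a function $s_F:X\times D\to\mathbb{R}_{\ge0}$; it is unitary iff $\sum_{a\in D}s_F(x,a)=1$ for all $x\in X$. The unladen weight of a valuation $v$ is $U_F(v)=\prod_{x\in X}s_F(x,v(x))$. Given weights $w_F(\sigma,x)$ for each solution $\sigma$ and variable $x$, the actual weight of $\sigma$ is $W_F(\sigma)=\prod_{x\in X}w_F(\sigma,x)$, and $W_F(S)=\sum_{\sigma\in S}W_F(\sigma)$ for a set $S$ of solutions. $w_F$ is decomposable by the family $(\delta_{F,\sigma,x,a})$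 iff $w_F(\sigma,x)=\sum_{a\in D}\delta_{F,\sigma,x,a}$ for all solutions $\sigma$ and all $x\in X$. For a solution $\sigma$ and a valuation $v$, $T_{F,\sigma\to v}=\prod_{x\in X}\delta_{F,\sigma,x,v(x)}$. For $S\subseteq\mathcal{S}(F)$, $(T_F,S)$ covers $U_F$ iff $\sum_{\sigma\in S}T_{F,\sigma\to v}\ge U_F(v)$ for all $v\in D^X$. *)

theory Defs
  imports Complex_Main "HOL-Library.FuncSet"
begin

text \<open>A constraint is a tuple of variables (a list, whose length is the arity) together with
  a relation, given as a set of tuples of values of that same length.\<close>

type_synonym ('x, 'd) csp_constraint = "'x list \<times> 'd list set"

record ('x, 'd) csp =
  csp_vars :: "'x set"
  csp_dom :: "'d set"
  csp_constraints :: "('x, 'd) csp_constraint set"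

definition constraint_over :: "'x set \<Rightarrow> 'd set \<Rightarrow> ('x, 'd) csp_constraint \<Rightarrow> bool" where
  "constraint_over X D c \<longleftrightarrow>
     set (fst c) \<subseteq> X \<and> snd c \<subseteq> {as. length as = length (fst c) \<and> set as \<subseteq> D}"

definition csp_instance :: "('x, 'd) csp \<Rightarrow> bool" where
  "csp_instance F \<longleftrightarrow> finite (csp_vars F) \<and> finite (csp_dom F) \<and>
     (\<forall>c \<in> csp_constraints F. constraint_over (csp_vars F) (csp_dom F) c)"

text \<open>The extensional function space makes a valuation the same thing as a map
  from variables to values: off the variables it is fixed to \<^const>\<open>undefined\<close>.\<close>

definition valuations :: "('x, 'd) csp \<Rightarrow> ('x \<Rightarrow> 'd) set" where
  "valuations F = csp_vars F \<rightarrow>\<^sub>E csp_dom F"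

definition satisfies :: "('x \<Rightarrow> 'd) \<Rightarrow> ('x, 'd) csp_constraint \<Rightarrow> bool" where
  "satisfies v c \<longleftrightarrow> map v (fst c) \<in> snd c"

definition solutions :: "('x, 'd) csp \<Rightarrow> ('x \<Rightarrow> 'd) set" where
  "solutions F = {v \<in> valuations F. \<forall>c \<in> csp_constraints F. satisfies v c}"

text \<open>Seeds, weights and the family \<open>\<delta>\<close> are total functions in HOL; only their values at
  solutions, variables and domain values of the instance are ever used.\<close>

definition weighting_seed :: "('x, 'd) csp \<Rightarrow> ('x \<Rightarrow> 'd \<Rightarrow> real) \<Rightarrow> bool" where
  "weighting_seed F s \<longleftrightarrow> (\<forall>x \<in> csp_vars F. \<forall>a \<in> csp_dom F. s x a \<ge> 0)"

definition unitary :: "('x, 'd) csp \<Rightarrow> ('x \<Rightarrow> 'd \<Rightarrow> real) \<Rightarrow> bool" where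
  "unitary F s \<longleftrightarrow> (\<forall>x \<in> csp_vars F. (\<Sum>a \<in> csp_dom F. s x a) = 1)"

definition unladen_weight ::
    "('x, 'd) csp \<Rightarrow> ('x \<Rightarrow> 'd \<Rightarrow> real) \<Rightarrow> ('x \<Rightarrow> 'd) \<Rightarrow> real" where
  "unladen_weight F s v = (\<Prod>x \<in> csp_vars F. s x (v x))"

definition actual_weight ::
    "('x, 'd) csp \<Rightarrow> (('x \<Rightarrow> 'd) \<Rightarrow> 'x \<Rightarrow> real) \<Rightarrow> ('x \<Rightarrow> 'd) \<Rightarrow> real" where
  "actual_weight F w \<sigma> = (\<Prod>x \<in> csp_vars F. w \<sigma> x)"

definition actual_weight_set ::
    "('x, 'd) csp \<Rightarrow> (('x \<Rightarrow> 'd) \<Rightarrow> 'x \<Rightarrow> real) \<Rightarrow> ('x \<Rightarrow> 'd) set \<Rightarrow> real" where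
  "actual_weight_set F w S = (\<Sum>\<sigma> \<in> S. actual_weight F w \<sigma>)"

definition decomposable_by ::
    "('x, 'd) csp \<Rightarrow> (('x \<Rightarrow> 'd) \<Rightarrow> 'x \<Rightarrow> real) \<Rightarrow> (('x \<Rightarrow> 'd) \<Rightarrow> 'x \<Rightarrow> 'd \<Rightarrow> real) \<Rightarrow> bool" where
  "decomposable_by F w \<delta> \<longleftrightarrow>
     (\<forall>\<sigma> \<in> solutions F. \<forall>x \<in> csp_vars F. w \<sigma> x = (\<Sum>a \<in> csp_dom F. \<delta> \<sigma> x a))"

definition transfer ::
    "('x, 'd) csp \<Rightarrow> (('x \<Rightarrow> 'd) \<Rightarrow> 'x \<Rightarrow> 'd \<Rightarrow> real) \<Rightarrow> ('x \<Rightarrow> 'd) \<Rightarrow> ('x \<Rightarrow> 'd) \<Rightarrow> real" where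
  "transfer F \<delta> \<sigma> v = (\<Prod>x \<in> csp_vars F. \<delta> \<sigma> x (v x))"

text \<open>The first function argument plays the role of \<open>T\<close>, the last that of \<open>U\<close>.\<close>

definition covers ::
    "('x, 'd) csp \<Rightarrow> (('x \<Rightarrow> 'd) \<Rightarrow> ('x \<Rightarrow> 'd) \<Rightarrow> real) \<Rightarrow> ('x \<Rightarrow> 'd) set \<Rightarrow> (('x \<Rightarrow> 'd) \<Rightarrow> real) \<Rightarrow> bool"
  where
  "covers F T S U \<longleftrightarrow> (\<forall>v \<in> valuations F. (\<Sum>\<sigma> \<in> S. T \<sigma> v) \<ge> U v)"

end

theory Submission
  imports Defs
begin

text \<open>Double counting of the total weight over all valuations. By distributivity
  (\<open>prod_sum_PiE\<close>), a product over variables of sums over values is the sum, over all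
  valuations, of products. For the unitary seed this gives total unladen weight 1. Covering bounds
  that by the total transfer out of \<open>S\<close>; the same identity applied to each \<sigma> in
  \<open>S\<close> collapses its transfers to its actual weight.\<close>

theorem theorem6:
  fixes F :: "('x, 'd) csp"
    and s :: "'x \<Rightarrow> 'd \<Rightarrow> real"
    and w :: "('x \<Rightarrow> 'd) \<Rightarrow> 'x \<Rightarrow> real"
    and \<delta> :: "('x \<Rightarrow> 'd) \<Rightarrow> 'x \<Rightarrow> 'd \<Rightarrow> real"
    and S :: "('x \<Rightarrow> 'd) set"
  assumes "csp_instance F"
    and "weighting_seed F s"
    and "S \<subseteq> solutions F"
    and "unitary F s"
    and "decomposable_by F w \<delta>"
    and "covers F (transfer F \<delta>) S (unladen_weight F s)"
  shows "actual_weight_set F w S \<ge> 1"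
proof -
  have fin: "finite (csp_vars F)" "finite (csp_dom F)"
    using assms(1) by (auto simp: csp_instance_def)
  have "1 = (\<Prod>x\<in>csp_vars F. \<Sum>a\<in>csp_dom F. s x a)"
    using assms(4) by (simp add: unitary_def)
  also have "\<dots> = (\<Sum>v\<in>valuations F. unladen_weight F s v)"
    using fin by (simp add: prod_sum_PiE valuations_def unladen_weight_def)
  also have "\<dots> \<le> (\<Sum>v\<in>valuations F. \<Sum>\<sigma>\<in>S. transfer F \<delta> \<sigma> v)"
    using assms(6) by (auto simp: covers_def intro: sum_mono)
  also have "\<dots> = (\<Sum>\<sigma>\<in>S. \<Sum>v\<in>valuations F. transfer F \<delta> \<sigma> v)"
    by (rule sum.swap)
  \<comment> \<open>With \<sigma> fixed, the sum factors because \<open>v\<close> runs through the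
    whole product space \<open>valuations F\<close>, not just the solutions.\<close>
  also have "\<dots> = (\<Sum>\<sigma>\<in>S. \<Prod>x\<in>csp_vars F. \<Sum>a\<in>csp_dom F. \<delta> \<sigma> x a)"
    using fin by (simp add: prod_sum_PiE valuations_def transfer_def)
  also have "\<dots> = actual_weight_set F w S"
    unfolding actual_weight_set_def actual_weight_def
    \<comment> \<open>Decomposability speaks only of solutions, hence the appeal to the inclusion of
      \<open>S\<close> in \<open>solutions F\<close>.\<close>
    using assms(3,5) by (intro sum.cong prod.cong) (auto simp: decomposable_by_def)
  finally show ?thesis .
qed

end
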